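(* Let $Y$ be a multigraph (multiple edges allowed, no loops). Then $Y$ is a generalized truncation of some reflexive multigraph if and only if $Y$ contains a perfect matching $M$ such that the submultigraph $Y\setminus M$, obtained from $Y$ by deleting the edges of $M$, is a graph (i.e. has no multiple edges).
   Context: A reflexive multigraph may have loops and multiple edges; a multigraph may have multiple edges but no loops; a graph has neither loops nor multiple edges. Reflexive multigraphs from which generalized truncations are formed are assumed to have no isolated vertices. Generalized truncation: let $X$ be a reflexive multigraph. Take a matching $M_0$ (pairwise vertex-disjoint edges, on $2|E(X)|$ new vertices) with $|M_0|=|E(X)|$ and a bijection $F:E(X)\to M_0$; for each edge $e$ of $X$ with ends $u,v$, label one end of $F(e)$ by $u$ and the other by $v$ (a loop at $v$ gives an edge with both ends labelled $v$). For $v\in V(X)$, the cluster $\mathrm{cl}(v)$ is the set of vertices of $M_0$ labelled $v$. On each $\mathrm{cl}(v)$ insert an arbitrary graph $\mathrm{con}(v)$ (the constituent at $v$). The multigraph $F(M_0)\cup\bigcup_{v\in V(X)}\mathrm{con}(v)$, and any multigraph isomorphic to it, is called a generalized truncation of $X$. *)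

theory Defs
  imports Main
begin

text \<open>
  The ends of an edge form a set, a singleton for a loop. The value of the field
  \<open>ends\<close> outside \<open>edges\<close> is irrelevant. Graphs may be infinite or empty.
\<close>

record ('v, 'e) mgraph =
  verts :: "'v set"
  edges :: "'e set"
  ends :: "'e \<Rightarrow> 'v set"

definition reflexive_multigraph :: "('v, 'e) mgraph \<Rightarrow> bool" where
  "reflexive_multigraph G \<longleftrightarrow>
     (\<forall>e\<in>edges G. ends G e \<subseteq> verts G \<and> (card (ends G e) = 1 \<or> card (ends G e) = 2))"

definition loopless :: "('v, 'e) mgraph \<Rightarrow> bool" where
  "loopless G \<longleftrightarrow> (\<forall>e\<in>edges G. card (ends G e) \<noteq> 1)"

definition no_multiple_edges :: "('v, 'e) mgraph \<Rightarrow> bool" where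
  "no_multiple_edges G \<longleftrightarrow> (\<forall>e\<in>edges G. \<forall>e'\<in>edges G. ends G e = ends G e' \<longrightarrow> e = e')"

definition multigraph :: "('v, 'e) mgraph \<Rightarrow> bool" where
  "multigraph G \<longleftrightarrow> reflexive_multigraph G \<and> loopless G"

definition graph :: "('v, 'e) mgraph \<Rightarrow> bool" where
  "graph G \<longleftrightarrow> multigraph G \<and> no_multiple_edges G"

definition no_isolated_vertices :: "('v, 'e) mgraph \<Rightarrow> bool" where
  "no_isolated_vertices G \<longleftrightarrow> (\<forall>v\<in>verts G. \<exists>e\<in>edges G. v \<in> ends G e)"

definition matching :: "('v, 'e) mgraph \<Rightarrow> 'e set \<Rightarrow> bool" where
  "matching G M \<longleftrightarrow> M \<subseteq> edges G \<and> (\<forall>e\<in>M. card (ends G e) = 2) \<and>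
     (\<forall>e\<in>M. \<forall>e'\<in>M. e \<noteq> e' \<longrightarrow> ends G e \<inter> ends G e' = {})"

definition perfect_matching :: "('v, 'e) mgraph \<Rightarrow> 'e set \<Rightarrow> bool" where
  "perfect_matching G M \<longleftrightarrow> matching G M \<and> (\<forall>v\<in>verts G. \<exists>e\<in>M. v \<in> ends G e)"

definition delete_edges :: "('v, 'e) mgraph \<Rightarrow> 'e set \<Rightarrow> ('v, 'e) mgraph" where
  "delete_edges G M = G\<lparr>edges := edges G - M\<rparr>"

definition isomorphic :: "('v, 'e) mgraph \<Rightarrow> ('w, 'f) mgraph \<Rightarrow> bool" where
  "isomorphic G H \<longleftrightarrow> (\<exists>f g. bij_betw f (verts G) (verts H) \<and> bij_betw g (edges G) (edges H) \<and>
     (\<forall>e\<in>edges G. ends H (g e) = f ` ends G e))"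

definition cluster :: "('d, 'm) mgraph \<Rightarrow> ('d \<Rightarrow> 'a) \<Rightarrow> 'a \<Rightarrow> 'd set" where
  "cluster M\<^sub>0 lab v = {x \<in> verts M\<^sub>0. lab x = v}"

text \<open>
  That all the edges of \<open>M\<^sub>0\<close> form a perfect matching says that \<open>M\<^sub>0\<close> consists of pairwise
  disjoint edges and their ends only. The image of the two ends of \<open>F e\<close> under the labelling
  being \<open>ends X e\<close> means that one end is labelled by each end of \<open>e\<close>, and both
  by the same vertex if \<open>e\<close> is a loop.
\<close>

definition truncation_data ::
  "('a, 'b) mgraph \<Rightarrow> ('d, 'm) mgraph \<Rightarrow> ('b \<Rightarrow> 'm) \<Rightarrow> ('d \<Rightarrow> 'a) \<Rightarrow> ('a \<Rightarrow> ('d, 'c) mgraph) \<Rightarrow> bool"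
where
  "truncation_data X M\<^sub>0 F lab con \<longleftrightarrow>
     reflexive_multigraph X \<and> no_isolated_vertices X \<and>
     multigraph M\<^sub>0 \<and> perfect_matching M\<^sub>0 (edges M\<^sub>0) \<and>
     bij_betw F (edges X) (edges M\<^sub>0) \<and>
     (\<forall>e\<in>edges X. lab ` ends M\<^sub>0 (F e) = ends X e) \<and>
     (\<forall>v\<in>verts X. graph (con v) \<and> verts (con v) = cluster M\<^sub>0 lab v)"

text \<open>
  The union of \<open>M\<^sub>0\<close> and all the constituents; the edge sets are made disjoint, so that an
  edge of a constituent may be parallel to an edge of \<open>M\<^sub>0\<close>.
\<close>

definition truncation_union ::
  "('a, 'b) mgraph \<Rightarrow> ('d, 'm) mgraph \<Rightarrow> ('a \<Rightarrow> ('d, 'c) mgraph) \<Rightarrow> ('d, 'm + 'a \<times> 'c) mgraph"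
where
  "truncation_union X M\<^sub>0 con =
     \<lparr>verts = verts M\<^sub>0 \<union> (\<Union>v\<in>verts X. verts (con v)),
      edges = edges M\<^sub>0 <+> (SIGMA v:verts X. edges (con v)),
      ends = case_sum (ends M\<^sub>0) (\<lambda>(v, c). ends (con v) c)\<rparr>"

text \<open>
  The types of \<open>M\<^sub>0\<close> and of the constituents are no restriction up to isomorphism: the vertices
  of \<open>M\<^sub>0\<close> are two for each edge of \<open>X\<close>, and an edge of a graph is determined by its
  set of ends.
\<close>

definition generalized_truncation :: "('a, 'b) mgraph \<Rightarrow> ('v, 'e) mgraph \<Rightarrow> bool" where
  "generalized_truncation X Y \<longleftrightarrow>
     (\<exists>(M\<^sub>0 :: ('b \<times> bool, 'b) mgraph) F lab (con :: 'a \<Rightarrow> ('b \<times> bool, ('b \<times> bool) set) mgraph).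
        truncation_data X M\<^sub>0 F lab con \<and> isomorphic (truncation_union X M\<^sub>0 con) Y)"

end

theory Submission
  imports Defs
begin

text \<open>
  In a generalized truncation the edges of \<open>M\<^sub>0\<close> form a perfect matching, and every other edge
  lies in a constituent; the constituents are graphs on pairwise disjoint vertex sets, so these
  edges have no parallels among themselves. Conversely, given a perfect matching \<open>M\<close> of \<open>Y\<close>, take
  for \<open>X\<close> a bouquet, i.e. one vertex with a loop for each edge in \<open>M\<close>: all of \<open>Y\<close> is then a
  single cluster, and \<open>Y\<close> without \<open>M\<close> may be inserted as its constituent.
\<close>

section \<open>Multigraphs and their isomorphisms\<close>

lemma edges_delete_edges [simp]: "edges (delete_edges G M) = edges G - M"
  and ends_delete_edges [simp]: "ends (delete_edges G M) = ends G"
  and verts_delete_edges [simp]: "verts (delete_edges G M) = verts G"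
  by (simp_all add: delete_edges_def)

lemma card_ends: "multigraph G \<Longrightarrow> e \<in> edges G \<Longrightarrow> card (ends G e) = 2"
  by (auto simp: multigraph_def reflexive_multigraph_def loopless_def)

lemma ends_subset: "multigraph G \<Longrightarrow> e \<in> edges G \<Longrightarrow> ends G e \<subseteq> verts G"
  by (auto simp: multigraph_def reflexive_multigraph_def)

lemma multigraphI:
  assumes "\<And>e. e \<in> edges G \<Longrightarrow> ends G e \<subseteq> verts G"
    and "\<And>e. e \<in> edges G \<Longrightarrow> card (ends G e) = 2"
  shows "multigraph G"
  using assms by (simp add: multigraph_def reflexive_multigraph_def loopless_def)

lemma multigraph_delete_edges: "multigraph G \<Longrightarrow> multigraph (delete_edges G M)"
  by (rule multigraphI) (simp_all add: card_ends ends_subset)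

text \<open>The inverse of the vertex bijection undoes it only on \<open>verts G\<close>, hence the
  hypothesis that ends are vertices.\<close>

lemma isomorphic_sym:
  assumes "\<And>e. e \<in> edges G \<Longrightarrow> ends G e \<subseteq> verts G" and "isomorphic G H"
  shows "isomorphic H G"
proof -
  obtain f g where f: "bij_betw f (verts G) (verts H)" and g: "bij_betw g (edges G) (edges H)"
    and fg: "\<And>e. e \<in> edges G \<Longrightarrow> ends H (g e) = f ` ends G e"
    using assms(2) unfolding isomorphic_def by blast
  have "ends G (inv_into (edges G) g e) = inv_into (verts G) f ` ends H e" if e: "e \<in> edges H" for e
  proof -
    obtain e' where e': "e' \<in> edges G" "e = g e'"
      using bij_betw_imp_surj_on[OF g] e by blast
    have "inv_into (edges G) g e = e'"
      using g e' by (simp add: bij_betw_def inv_into_f_f)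
    moreover have "inv_into (verts G) f ` f ` ends G e' = ends G e'"
      using f assms(1)[OF e'(1)] by (simp add: bij_betw_def inv_into_image_cancel)
    ultimately show ?thesis
      using e' fg by simp
  qed
  then show ?thesis
    unfolding isomorphic_def using bij_betw_inv_into[OF f] bij_betw_inv_into[OF g] by blast
qed

text \<open>Generalized truncations are taken up to isomorphism, so the matching has to be carried
  along one. Injectivity of the vertex map on \<open>verts G\<close> makes images of end sets keep
  their size, their disjointness and their distinctness.\<close>

lemma isomorphic_perfect_matching:
  assumes G: "multigraph G" and iso: "isomorphic G H"
    and M: "perfect_matching G M" and simple: "no_multiple_edges (delete_edges G M)"
  shows "\<exists>N. perfect_matching H N \<and> no_multiple_edges (delete_edges H N)"
proof -
  obtain f g where f: "bij_betw f (verts G) (verts H)" and g: "bij_betw g (edges G) (edges H)"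
    and fg: "\<And>e. e \<in> edges G \<Longrightarrow> ends H (g e) = f ` ends G e"
    using iso unfolding isomorphic_def by blast
  have inj: "inj_on f (verts G)" and surj: "f ` verts G = verts H"
    and gsurj: "g ` edges G = edges H"
    using f g by (auto simp: bij_betw_def)
  have sub: "M \<subseteq> edges G"
    and disj: "\<And>e e'. e \<in> M \<Longrightarrow> e' \<in> M \<Longrightarrow> e \<noteq> e' \<Longrightarrow> ends G e \<inter> ends G e' = {}"
    and cover: "\<And>v. v \<in> verts G \<Longrightarrow> \<exists>e\<in>M. v \<in> ends G e"
    using M by (auto simp: perfect_matching_def matching_def)
  have card2: "card (ends H (g e)) = 2" if "e \<in> M" for e
    using that sub fg card_ends[OF G] ends_subset[OF G] card_image inj_on_subset[OF inj]
    by (metis subsetD)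
  have disj': "ends H (g e) \<inter> ends H (g e') = {}" if "e \<in> M" "e' \<in> M" "e \<noteq> e'" for e e'
  proof -
    have "f ` (ends G e \<inter> ends G e') = f ` ends G e \<inter> f ` ends G e'"
      using that sub ends_subset[OF G] by (intro inj_on_image_Int[OF inj]) auto
    then show ?thesis
      using that sub fg disj by (metis image_empty subsetD)
  qed
  have "perfect_matching H (g ` M)"
    unfolding perfect_matching_def matching_def
  proof (intro conjI ballI impI)
    show "g ` M \<subseteq> edges H"
      using sub gsurj by blast
    show "card (ends H e) = 2" if "e \<in> g ` M" for e
      using that card2 by blast
    show "ends H e \<inter> ends H e' = {}" if "e \<in> g ` M" "e' \<in> g ` M" "e \<noteq> e'" for e e'
      using that disj' by (metis imageE)
    show "\<exists>e\<in>g ` M. v \<in> ends H e" if v: "v \<in> verts H" for v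
    proof -
      obtain u where u: "u \<in> verts G" "v = f u"
        using v surj by blast
      obtain e where "e \<in> M" "u \<in> ends G e"
        using cover[OF u(1)] by (elim bexE)
      moreover from this have "v \<in> ends H (g e)"
        using u sub fg[of e] by auto
      ultimately show ?thesis
        by (intro bexI[of _ "g e"] imageI)
    qed
  qed
  moreover have "no_multiple_edges (delete_edges H (g ` M))"
    unfolding no_multiple_edges_def
  proof (intro ballI impI)
    fix e e'
    assume "e \<in> edges (delete_edges H (g ` M))" "e' \<in> edges (delete_edges H (g ` M))"
      and eq: "ends (delete_edges H (g ` M)) e = ends (delete_edges H (g ` M)) e'"
    then have "e \<in> g ` (edges G - M)" "e' \<in> g ` (edges G - M)"
      by (auto simp flip: gsurj)
    then obtain d d' where d: "d \<in> edges G - M" "e = g d" "d' \<in> edges G - M" "e' = g d'"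
      by blast
    then have "f ` ends G d = f ` ends G d'"
      using eq fg by simp
    then have "ends G d = ends G d'"
      using d inj_on_image_eq_iff[OF inj ends_subset[OF G] ends_subset[OF G]] by simp
    then show "e = e'"
      using d simple by (auto simp: no_multiple_edges_def)
  qed
  ultimately show ?thesis
    by blast
qed

section \<open>The perfect matching of a generalized truncation\<close>

lemma truncation_union_perfect_matching:
  assumes "truncation_data X M\<^sub>0 F lab con"
  defines "T \<equiv> truncation_union X M\<^sub>0 con"
  shows "multigraph T \<and> perfect_matching T (Inl ` edges M\<^sub>0) \<and>
    no_multiple_edges (delete_edges T (Inl ` edges M\<^sub>0))"
proof (intro conjI)
  have M0: "multigraph M\<^sub>0" "perfect_matching M\<^sub>0 (edges M\<^sub>0)"
    and con: "\<And>v. v \<in> verts X \<Longrightarrow> multigraph (con v)"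
      "\<And>v. v \<in> verts X \<Longrightarrow> no_multiple_edges (con v)"
      "\<And>v. v \<in> verts X \<Longrightarrow> verts (con v) = cluster M\<^sub>0 lab v"
    using assms(1) by (auto simp: truncation_data_def graph_def)
  \<comment> \<open>The constituents live on clusters and so add no vertices; thus the edges of
    \<open>M\<^sub>0\<close> still cover everything.\<close>
  have vertsT: "verts T = verts M\<^sub>0"
    using con(3) by (auto simp: T_def truncation_union_def cluster_def)
  have edgesT: "edges T = edges M\<^sub>0 <+> (SIGMA v:verts X. edges (con v))"
    and endsT: "ends T = case_sum (ends M\<^sub>0) (\<lambda>(v, c). ends (con v) c)"
    by (simp_all add: T_def truncation_union_def)
  have in_cluster: "ends (con v) c \<subseteq> cluster M\<^sub>0 lab v" if "v \<in> verts X" "c \<in> edges (con v)" for v c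
    using that con ends_subset by metis
  show "multigraph T"
  proof (rule multigraphI)
    fix e assume e: "e \<in> edges T"
    show "ends T e \<subseteq> verts T"
      using e ends_subset[OF M0(1)] in_cluster
      by (fastforce simp: edgesT endsT vertsT cluster_def)
    show "card (ends T e) = 2"
      using e card_ends[OF M0(1)] card_ends[OF con(1)] by (auto simp: edgesT endsT)
  qed
  show "perfect_matching T (Inl ` edges M\<^sub>0)"
    using M0(2) by (auto simp: perfect_matching_def matching_def vertsT edgesT endsT)
  \<comment> \<open>Parallel edges of constituents share an end, and its label determines the
    constituent containing both.\<close>
  have "v = v' \<and> c = c'"
    if "v \<in> verts X" "c \<in> edges (con v)" "v' \<in> verts X" "c' \<in> edges (con v')"
      "ends (con v) c = ends (con v') c'" for v c v' c'
  proof -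
    have "card (ends (con v) c) = 2"
      using that(2) by (rule card_ends[OF con(1)[OF that(1)]])
    then obtain x where "x \<in> ends (con v) c"
      by (metis card.empty ex_in_conv zero_neq_numeral)
    then have "v = v'"
      using that in_cluster[OF that(1,2)] in_cluster[OF that(3,4)] by (auto simp: cluster_def)
    then show ?thesis
      using that con(2) by (auto simp: no_multiple_edges_def)
  qed
  then show "no_multiple_edges (delete_edges T (Inl ` edges M\<^sub>0))"
    by (auto simp: no_multiple_edges_def edgesT endsT)
qed

lemma generalized_truncation_perfect_matching:
  fixes X :: "('a, 'b) mgraph" and Y :: "('v, 'e) mgraph"
  assumes "multigraph Y" and "generalized_truncation X Y"
  shows "\<exists>M. perfect_matching Y M \<and> graph (delete_edges Y M)"
proof -
  obtain M\<^sub>0 :: "('b \<times> bool, 'b) mgraph" and F lab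
    and con :: "'a \<Rightarrow> ('b \<times> bool, ('b \<times> bool) set) mgraph"
    where data: "truncation_data X M\<^sub>0 F lab con"
    and iso: "isomorphic (truncation_union X M\<^sub>0 con) Y"
    using assms(2) unfolding generalized_truncation_def by blast
  show ?thesis
    using isomorphic_perfect_matching[OF _ iso] truncation_union_perfect_matching[OF data]
      multigraph_delete_edges[OF assms(1)]
    unfolding graph_def by blast
qed

section \<open>Realizing a multigraph as a truncation of a bouquet\<close>

text \<open>
  The vertex set of the bouquet is an image of \<open>M\<close>, so that it is empty if \<open>M\<close> is: otherwise its
  only vertex would be isolated.
\<close>

lemma perfect_matching_generalized_truncation:
  fixes Y :: "('v, 'e) mgraph" and a :: 'a
  assumes Y: "multigraph Y" and M: "perfect_matching Y M" and simple: "graph (delete_edges Y M)"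
  defines "X \<equiv> \<lparr>verts = (\<lambda>_. a) ` M, edges = M, ends = \<lambda>_. {a}\<rparr>"
  shows "generalized_truncation X Y"
proof -
  have sub: "M \<subseteq> edges Y"
    and disj: "\<And>e e'. e \<in> M \<Longrightarrow> e' \<in> M \<Longrightarrow> e \<noteq> e' \<Longrightarrow> ends Y e \<inter> ends Y e' = {}"
    and cover: "\<And>v. v \<in> verts Y \<Longrightarrow> \<exists>e\<in>M. v \<in> ends Y e"
    using M by (auto simp: perfect_matching_def matching_def)
  have "\<forall>e\<in>M. \<exists>p q. ends Y e = {p, q} \<and> p \<noteq> q"
    using sub card_ends[OF Y] by (meson card_2_iff subsetD)
  then obtain p q where pq: "\<And>e. e \<in> M \<Longrightarrow> ends Y e = {p e, q e}" "\<And>e. e \<in> M \<Longrightarrow> p e \<noteq> q e"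
    by metis
  \<comment> \<open>\<open>D\<close> will be the vertex set of \<open>M\<^sub>0\<close>, two new
    vertices for each matching edge; \<open>h\<close> identifies it with
    \<open>verts Y\<close>.\<close>
  define D where "D = M \<times> (UNIV :: bool set)"
  define h where "h = (\<lambda>(e, b). if b then p e else q e)"
  have h_in: "h (e, b) \<in> ends Y e" if "e \<in> M" for e b
    using that pq by (simp add: h_def)
  \<comment> \<open>Disjointness of the matching edges recovers \<open>e\<close> from the value of
    \<open>h\<close>, and \<open>p e \<noteq> q e\<close> then recovers the boolean.\<close>
  have "inj_on h D"
  proof (rule inj_onI)
    fix x y assume xy: "x \<in> D" "y \<in> D" "h x = h y"
    obtain e b e' b' where [simp]: "x = (e, b)" "y = (e', b')"
      by (meson surj_pair)
    have M: "e \<in> M" "e' \<in> M"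
      using xy by (auto simp: D_def)
    then have "e = e'"
      using xy h_in disj by (metis IntI \<open>x = (e, b)\<close> \<open>y = (e', b')\<close> empty_iff)
    moreover have "b = b'"
      using xy pq(2)[OF M(1)] \<open>e = e'\<close> by (auto simp: h_def split: if_splits)
    ultimately show "x = y"
      by simp
  qed
  moreover have "h ` D = verts Y"
  proof
    show "h ` D \<subseteq> verts Y"
      using h_in sub ends_subset[OF Y] by (fastforce simp: D_def)
    show "verts Y \<subseteq> h ` D"
    proof
      fix v assume "v \<in> verts Y"
      then obtain e where e: "e \<in> M" "v = p e \<or> v = q e"
        using cover pq(1) by blast
      \<comment> \<open>The truth value of \<open>v = p e\<close> selects the end of
        \<open>e\<close> that is \<open>v\<close>.\<close>
      then have "v = h (e, v = p e)"
        by (auto simp: h_def)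
      then show "v \<in> h ` D"
        using e(1) by (auto simp: D_def)
    qed
  qed
  ultimately have h: "bij_betw h D (verts Y)"
    by (simp add: bij_betw_def)
  define k where "k = inv_into D h"
  have k: "bij_betw k (verts Y) D"
    unfolding k_def using h by (rule bij_betw_inv_into)
  then have kinj: "inj_on k (verts Y)"
    by (rule bij_betw_imp_inj_on)
  have kh: "k (h x) = x" if "x \<in> D" for x
    using h that by (simp add: k_def bij_betw_def)
  have k_ends: "k ` ends Y e = {(e, True), (e, False)}" if "e \<in> M" for e
    using that kh[of "(e, True)"] kh[of "(e, False)"] pq(1) by (simp add: h_def D_def)
  \<comment> \<open>An edge of the constituent will be its own set of ends. Naming edges in this way
    is injective because \<open>Y\<close> without \<open>M\<close> has no multiple edges.\<close>
  have k_inj: "e = e'" if "e \<in> edges Y - M" "e' \<in> edges Y - M" "k ` ends Y e = k ` ends Y e'" for e e'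
  proof -
    have "ends Y e = ends Y e'"
      using that inj_on_image_eq_iff[OF kinj ends_subset[OF Y] ends_subset[OF Y]] by simp
    then show ?thesis
      using that simple by (simp add: graph_def no_multiple_edges_def)
  qed
  \<comment> \<open>If \<open>M\<close> were empty, the bouquet would have no vertex and hence no
    constituent to hold the other edges of \<open>Y\<close>.\<close>
  have M_nonempty: "M \<noteq> {}" if e: "e \<in> edges Y" for e
  proof -
    obtain v where "v \<in> ends Y e"
      using card_ends[OF Y e] by (metis card.empty ex_in_conv zero_neq_numeral)
    then show ?thesis
      using cover ends_subset[OF Y e] by blast
  qed
  define M\<^sub>0 :: "('e \<times> bool, 'e) mgraph" where
    "M\<^sub>0 = \<lparr>verts = D, edges = M, ends = \<lambda>e. {(e, True), (e, False)}\<rparr>"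
  \<comment> \<open>This is \<open>Y\<close> without \<open>M\<close>, transported to
    \<open>D\<close> along \<open>k\<close>.\<close>
  define C :: "('e \<times> bool, ('e \<times> bool) set) mgraph" where
    "C = \<lparr>verts = D, edges = (\<lambda>e. k ` ends Y e) ` (edges Y - M), ends = \<lambda>s. s\<rparr>"
  let ?T = "truncation_union X M\<^sub>0 (\<lambda>_. C)"
  have "graph C"
    unfolding graph_def
  proof
    show "multigraph C"
    proof (rule multigraphI)
      fix s assume "s \<in> edges C"
      then obtain e where e: "e \<in> edges Y" "s = k ` ends Y e"
        by (auto simp: C_def)
      show "ends C s \<subseteq> verts C"
        using e ends_subset[OF Y] bij_betw_imp_surj_on[OF k] by (auto simp: C_def)
      show "card (ends C s) = 2"
        using e card_image[OF inj_on_subset[OF kinj ends_subset[OF Y e(1)]]] card_ends[OF Y]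
        by (simp add: C_def)
    qed
    show "no_multiple_edges C"
      by (simp add: no_multiple_edges_def C_def)
  qed
  \<comment> \<open>Each edge of \<open>M\<^sub>0\<close> stands for the loop of the same name. The
    constant labelling makes the cluster at \<open>a\<close> all of \<open>D\<close>.\<close>
  then have "truncation_data X M\<^sub>0 (\<lambda>e. e) (\<lambda>_. a) (\<lambda>_. C)"
    by (auto simp: truncation_data_def X_def M\<^sub>0_def C_def D_def cluster_def perfect_matching_def
        matching_def multigraph_def reflexive_multigraph_def loopless_def no_isolated_vertices_def
        bij_betw_def)
  moreover have "isomorphic Y ?T"
    unfolding isomorphic_def
  proof (intro exI conjI ballI)
    \<comment> \<open>Matching edges go to the summand of \<open>M\<^sub>0\<close>, all others to
      the constituent at \<open>a\<close>.\<close>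
    let ?g = "\<lambda>e. if e \<in> M then Inl e else Inr (a, k ` ends Y e)"
    show "bij_betw k (verts Y) (verts ?T)"
    proof -
      have "verts ?T = D"
        by (auto simp: truncation_union_def M\<^sub>0_def C_def)
      then show ?thesis
        using k by simp
    qed
    show "bij_betw ?g (edges Y) (edges ?T)"
      unfolding bij_betw_def
    proof
      show "inj_on ?g (edges Y)"
        using k_inj by (auto simp: inj_on_def)
      show "?g ` edges Y = edges ?T"
      proof -
        have "edges ?T = Inl ` M \<union> (\<lambda>e. Inr (a, k ` ends Y e)) ` (edges Y - M)"
          using M_nonempty by (auto simp: truncation_union_def M\<^sub>0_def C_def X_def)
        moreover have "?g ` edges Y = ?g ` M \<union> ?g ` (edges Y - M)"
          using sub by blast
        ultimately show ?thesis
          by simp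
      qed
    qed
    show "ends ?T (?g e) = k ` ends Y e" if "e \<in> edges Y" for e
      using k_ends by (simp add: truncation_union_def M\<^sub>0_def C_def)
  qed
  then have "isomorphic ?T Y"
    using isomorphic_sym ends_subset[OF Y] by blast
  ultimately show ?thesis
    unfolding generalized_truncation_def by blast
qed

text \<open>The bouquet has edge set \<open>M\<close> and one vertex at most, which may be any
  element of \<open>'v\<close>, so the types of \<open>Y\<close> suffice for the existence of
  \<open>X\<close>. The second conjunct extends the forward direction to \<open>X\<close> over
  arbitrary types.\<close>

theorem theorem2p1:
  fixes Y :: "('v, 'e) mgraph"
  assumes "multigraph Y"
  shows "((\<exists>X :: ('v, 'e) mgraph. generalized_truncation X Y) \<longleftrightarrow>
            (\<exists>M. perfect_matching Y M \<and> graph (delete_edges Y M)))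
       \<and> (\<forall>X :: ('a, 'b) mgraph. generalized_truncation X Y \<longrightarrow>
            (\<exists>M. perfect_matching Y M \<and> graph (delete_edges Y M)))"
proof (intro conjI iffI allI impI)
  show "\<exists>M. perfect_matching Y M \<and> graph (delete_edges Y M)"
    if "\<exists>X :: ('v, 'e) mgraph. generalized_truncation X Y"
    using that generalized_truncation_perfect_matching[OF assms] by (elim exE)
  show "\<exists>X :: ('v, 'e) mgraph. generalized_truncation X Y"
    if "\<exists>M. perfect_matching Y M \<and> graph (delete_edges Y M)"
    using that by (elim exE conjE) (rule exI, rule perfect_matching_generalized_truncation[OF assms])
  show "\<exists>M. perfect_matching Y M \<and> graph (delete_edges Y M)"
    if "generalized_truncation X Y" for X :: "('a, 'b) mgraph"
    using assms that by (rule generalized_truncation_perfect_matching)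
qed

end
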